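(* Let $E$ be an effect algebra. For every coexistent subset $S$ of $E$, the set $S\cup\{1\}$ admits a strong compatibility support mapping.
   Context: An effect algebra is a partial algebra $(E;\oplus,0,1)$ with a partial binary operation $\oplus$ and constants $0,1$ such that: (E1) if $a\oplus b$ is defined, then $b\oplus a$ is defined and $a\oplus b=b\oplus a$; (E2) if $a\oplus b$ and $(a\oplus b)\oplus c$ are defined, then $b\oplus c$ and $a\oplus(b\oplus c)$ are defined and $(a\oplus b)\oplus c=a\oplus(b\oplus c)$; (E3) for every $a\in E$ there is a unique $a'\in E$ with $a\oplus a'=1$; (E4) if $a\oplus 1$ exists, then $a=0$. One writes $a\le b$ iff there is $c\in E$ with $a\oplus c=b$; this is a partial order with least element $0$ and greatest element $1$. The element $b\ominus a$ is defined iff $a\le b$, and then it is the unique element with $a\oplus(b\ominus a)=b$. For a set $S$, $\mathrm{Fin}(S)$ denotes the set of all finite subsets of $S$ (including $\emptyset$). Let $T\subseteq E$ with $1\in T$. A compatibility support mapping for $T$ is a mapping $[\![\cdot,\cdot]\!]:\mathrm{Fin}(T)\times\mathrm{Fin}(T)\to E$ such that for all $U,V,V_1,V_2\in\mathrm{Fin}(T)$ and $c\in T$: (a) if $V_1\subseteq V_2$ then $[\![U,V_1]\!]\le[\![U,V_2]\!]$; (b) $[\![U,V]\!]\le[\![U,\{1\}]\!]$; (c) $[\![U,\emptyset]\!]=0$; (d) $[\![\emptyset,\{c\}]\!]=c$; (e) if $c\notin U\cup V$, then $[\![U\cup\{c\},\{1\}]\!]\ominus[\![U\cup\{c\},V]\!]=[\![U,V\cup\{c\}]\!]\ominus[\![U,V]\!]$.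 It is strong if moreover (e* ) the equality in (e) holds for all $U,V\in\mathrm{Fin}(T)$ and all $c\in T$ (without the restriction $c\notin U\cup V$). "$T$ admits a strong compatibility support mapping" means that such a mapping exists. An observable is a mapping $\alpha:B\to E$ from a Boolean algebra $B$ such that $\alpha(0)=0$, $\alpha(1)=1$ and, for all $x,y\in B$ with $x\wedge y=0$, $\alpha(x\vee y)=\alpha(x)\oplus\alpha(y)$ (in particular the right-hand side is defined). A subset $S\subseteq E$ is coexistent if there are a Boolean algebra $B$ and an observable $\alpha:B\to E$ with $S\subseteq\alpha(B)$. *)

theory Defs
  imports Main
begin

text \<open>The underlying set of an effect algebra is the whole type; the partial sum of two elements is
  undefined iff its value is \<^const>\<open>None\<close>.\<close>

locale effect_algebra =
  fixes oplus :: "'a \<Rightarrow> 'a \<Rightarrow> 'a option"  (infixl \<open>\<oplus>\<close> 65)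
    and zero :: 'a  (\<open>\<zero>\<close>)
    and one :: 'a  (\<open>\<one>\<close>)
  assumes E1: "a \<oplus> b = Some s \<Longrightarrow> b \<oplus> a = Some s"
    and E2: "a \<oplus> b = Some s \<Longrightarrow> s \<oplus> c = Some t \<Longrightarrow> \<exists>u. b \<oplus> c = Some u \<and> a \<oplus> u = Some t"
    and E3: "\<exists>!a'. a \<oplus> a' = Some \<one>"
    and E4: "a \<oplus> \<one> \<noteq> None \<Longrightarrow> a = \<zero>"
begin

definition le :: "'a \<Rightarrow> 'a \<Rightarrow> bool"  (infix \<open>\<preceq>\<close> 50)
  where "a \<preceq> b \<longleftrightarrow> (\<exists>c. a \<oplus> c = Some b)"

definition ominus :: "'a \<Rightarrow> 'a \<Rightarrow> 'a option"  (infixl \<open>\<ominus>\<close> 65)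
  where "b \<ominus> a = (if a \<preceq> b then Some (THE c. a \<oplus> c = Some b) else None)"

text \<open>A mapping on pairs of finite subsets of \<open>T\<close> is a curried total function \<open>F\<close>, of which only the
  values on \<^term>\<open>Fpow T\<close>, the set of finite subsets of \<open>T\<close>, matter. In the last condition of the next
  definition, the first two conditions guarantee that both differences are defined, so the equation
  never holds merely because both sides are \<^const>\<open>None\<close>. The same applies to strong mappings.\<close>

definition compatibility_support_mapping :: "'a set \<Rightarrow> ('a set \<Rightarrow> 'a set \<Rightarrow> 'a) \<Rightarrow> bool"
  where "compatibility_support_mapping T F \<longleftrightarrow>
    \<one> \<in> T \<and>
    (\<forall>U\<in>Fpow T. \<forall>V1\<in>Fpow T. \<forall>V2\<in>Fpow T. V1 \<subseteq> V2 \<longrightarrow> F U V1 \<preceq> F U V2) \<and>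
    (\<forall>U\<in>Fpow T. \<forall>V\<in>Fpow T. F U V \<preceq> F U {\<one>}) \<and>
    (\<forall>U\<in>Fpow T. F U {} = \<zero>) \<and>
    (\<forall>c\<in>T. F {} {c} = c) \<and>
    (\<forall>U\<in>Fpow T. \<forall>V\<in>Fpow T. \<forall>c\<in>T. c \<notin> U \<union> V \<longrightarrow>
       F (U \<union> {c}) {\<one>} \<ominus> F (U \<union> {c}) V = F U (V \<union> {c}) \<ominus> F U V)"

definition strong_compatibility_support_mapping :: "'a set \<Rightarrow> ('a set \<Rightarrow> 'a set \<Rightarrow> 'a) \<Rightarrow> bool"
  where "strong_compatibility_support_mapping T F \<longleftrightarrow>
    compatibility_support_mapping T F \<and>
    (\<forall>U\<in>Fpow T. \<forall>V\<in>Fpow T. \<forall>c\<in>T.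
       F (U \<union> {c}) {\<one>} \<ominus> F (U \<union> {c}) V = F U (V \<union> {c}) \<ominus> F U V)"

definition admits_strong_compatibility_support_mapping :: "'a set \<Rightarrow> bool"
  where "admits_strong_compatibility_support_mapping T \<longleftrightarrow>
    (\<exists>F. strong_compatibility_support_mapping T F)"

definition observable :: "('b::boolean_algebra \<Rightarrow> 'a) \<Rightarrow> bool"
  where "observable \<alpha> \<longleftrightarrow>
    \<alpha> bot = \<zero> \<and> \<alpha> top = \<one> \<and>
    (\<forall>x y. inf x y = bot \<longrightarrow> \<alpha> x \<oplus> \<alpha> y = Some (\<alpha> (sup x y)))"

text \<open>A definition cannot quantify existentially over types, so the type that carries the Boolean
  algebra is an argument. Being coexistent means being coexistent for some such type; when this is
  an assumption, the quantifier becomes a universal one over the type variable \<open>'b\<close>.\<close>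

definition coexistent :: "'b::boolean_algebra itself \<Rightarrow> 'a set \<Rightarrow> bool"
  where "coexistent (_ :: 'b itself) S \<longleftrightarrow>
    (\<exists>\<alpha> :: 'b \<Rightarrow> 'a. observable \<alpha> \<and> S \<subseteq> range \<alpha>)"

end

end

theory Submission
  imports Defs
begin

text \<open>Compatibility support mappings imitate, inside an effect algebra, an expression that can be
  formed in a Boolean algebra. Let \<open>\<alpha>\<close> be an observable whose range contains \<open>S\<close>, and let \<open>g\<close> choose an
  \<open>\<alpha>\<close>-preimage of each element of \<open>S \<union> {\<one>}\<close>, with \<open>g \<one> = top\<close>. The mapping is
  \<open>F U V = \<alpha> (x \<sqinter> y)\<close>, where \<open>x\<close> is the meet of \<open>g ` U\<close> and \<open>y\<close> the join of \<open>g ` V\<close>. As observables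
  turn differences \<open>y - x\<close> of comparable elements into differences in the effect algebra, each
  condition comes from a Boolean law. For the exchange condition, both differences are the value
  of \<open>\<alpha>\<close> at \<open>x \<sqinter> g c \<sqinter> - y\<close>, and the Boolean identities used for this hold for every \<open>c\<close>; so the
  mapping is strong. The choice \<open>g \<one> = top\<close> makes \<open>F U {\<one>}\<close> the value of \<open>\<alpha>\<close> at the meet of \<open>g ` U\<close>.\<close>

text \<open>Adjoining the neutral element makes the meet and the join of the empty set meaningful.\<close>

definition meet_image :: "('a \<Rightarrow> 'b::boolean_algebra) \<Rightarrow> 'a set \<Rightarrow> 'b"
  where "meet_image g U = Inf_fin (insert top (g ` U))"

definition join_image :: "('a \<Rightarrow> 'b::boolean_algebra) \<Rightarrow> 'a set \<Rightarrow> 'b"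
  where "join_image g V = Sup_fin (insert bot (g ` V))"

lemma meet_image_empty [simp]: "meet_image g {} = top"
  by (simp add: meet_image_def)

lemma join_image_empty [simp]: "join_image g {} = bot"
  by (simp add: join_image_def)

lemma meet_image_insert [simp]:
  "finite U \<Longrightarrow> meet_image g (insert c U) = inf (g c) (meet_image g U)"
  by (simp add: meet_image_def insert_commute [of top] Inf_fin.insert)

lemma join_image_insert [simp]:
  "finite V \<Longrightarrow> join_image g (insert c V) = sup (g c) (join_image g V)"
  by (simp add: join_image_def insert_commute [of bot] Sup_fin.insert)

lemma join_image_mono: "finite V \<Longrightarrow> W \<subseteq> V \<Longrightarrow> join_image g W \<le> join_image g V"
  unfolding join_image_def by (rule Sup_fin.subset_imp) auto

context effect_algebra
begin

text \<open>The complement \<open>w\<close> of \<open>b\<close> is \<open>s' \<oplus> a\<close>, where \<open>s'\<close> is the complement of \<open>s = a \<oplus> b\<close>. This does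
  not mention \<open>b\<close>, so \<open>w\<close> is also the complement of \<open>c\<close>, and complements are unique.\<close>

lemma oplus_left_cancel:
  assumes "a \<oplus> b = Some s" and "a \<oplus> c = Some s"
  shows "b = c"
proof -
  obtain s' where s': "s \<oplus> s' = Some \<one>"
    using E3 by blast
  have complement: "\<exists>w. s' \<oplus> a = Some w \<and> w \<oplus> d = Some \<one>" if sum: "a \<oplus> d = Some s" for d
  proof -
    obtain u where "d \<oplus> s' = Some u" "a \<oplus> u = Some \<one>"
      using E2 [OF sum s'] by blast
    then show ?thesis
      using E1 E2 by metis
  qed
  show ?thesis
    using complement [OF assms(1)] complement [OF assms(2)] E3 by (metis option.inject)
qed

lemma ominus_eqI:
  assumes "a \<oplus> c = Some b"
  shows "b \<ominus> a = Some c"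
proof -
  have "(THE c. a \<oplus> c = Some b) = c"
    using assms oplus_left_cancel by blast
  then show ?thesis
    using assms by (auto simp: ominus_def le_def)
qed

lemma observable_oplus_diff:
  fixes \<alpha> :: "'b::boolean_algebra \<Rightarrow> 'a"
  assumes "observable \<alpha>" and "x \<le> y"
  shows "\<alpha> x \<oplus> \<alpha> (y - x) = Some (\<alpha> y)"
proof -
  have "inf x (y - x) = bot"
    by (simp add: diff_eq inf.left_commute)
  moreover have "sup x (y - x) = y"
    using assms(2) by (simp add: diff_eq sup_inf_distrib1 sup_absorb2)
  ultimately show ?thesis
    using assms(1) unfolding observable_def by metis
qed

lemma observable_mono:
  "observable \<alpha> \<Longrightarrow> x \<le> y \<Longrightarrow> \<alpha> x \<preceq> \<alpha> y"
  unfolding le_def using observable_oplus_diff by blast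

lemma observable_ominus:
  "observable \<alpha> \<Longrightarrow> x \<le> y \<Longrightarrow> \<alpha> y \<ominus> \<alpha> x = Some (\<alpha> (y - x))"
  by (intro ominus_eqI observable_oplus_diff)

text \<open>Removing \<open>y\<close> from \<open>z \<sqinter> x\<close>, and adding \<open>z\<close> to \<open>y\<close> within \<open>x\<close>, both account for the part of
  \<open>z \<sqinter> x\<close> outside \<open>y\<close>. This is the exchange condition when \<open>x\<close> is the meet of the preimages of the
  elements of \<open>U\<close>, \<open>y\<close> the join of those of \<open>V\<close>, and \<open>z\<close> the preimage of \<open>c\<close>.\<close>

lemma observable_exchange:
  fixes \<alpha> :: "'b::boolean_algebra \<Rightarrow> 'a"
  assumes "observable \<alpha>"
  shows "\<alpha> (inf z x) \<ominus> \<alpha> (inf (inf z x) y) = \<alpha> (inf x (sup z y)) \<ominus> \<alpha> (inf x y)"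
proof -
  have "inf z x - inf (inf z x) y = inf (inf z x) (- y)"
    by (simp add: diff_eq inf_sup_distrib1 inf_assoc inf_left_commute)
  also have "\<dots> = inf x (sup z y) - inf x y"
    by (simp add: diff_eq inf_sup_distrib1 inf_sup_distrib2 inf_assoc inf_commute inf_left_commute)
  finally have differences: "inf z x - inf (inf z x) y = inf x (sup z y) - inf x y" .
  have "\<alpha> (inf z x) \<ominus> \<alpha> (inf (inf z x) y) = Some (\<alpha> (inf z x - inf (inf z x) y))"
    by (rule observable_ominus [OF assms inf_le1])
  moreover have "\<alpha> (inf x (sup z y)) \<ominus> \<alpha> (inf x y) = Some (\<alpha> (inf x (sup z y) - inf x y))"
    by (intro observable_ominus [OF assms] inf_mono) simp_all
  ultimately show ?thesis
    by (simp only: differences)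
qed

lemma strong_mapping_of_observable:
  fixes \<alpha> :: "'b::boolean_algebra \<Rightarrow> 'a"
  assumes obs: "observable \<alpha>" and "\<one> \<in> T"
    and preimage: "\<And>c. c \<in> T \<Longrightarrow> \<alpha> (g c) = c" and g_one: "g \<one> = top"
  shows "strong_compatibility_support_mapping T
    (\<lambda>U V. \<alpha> (inf (meet_image g U) (join_image g V)))"
    (is "strong_compatibility_support_mapping T ?F")
proof -
  have mono: "?F U V1 \<preceq> ?F U V2" if "V2 \<in> Fpow T" "V1 \<subseteq> V2" for U V1 V2
    using that by (intro observable_mono [OF obs] inf_mono join_image_mono) (auto simp: Fpow_def)
  have full: "?F U {\<one>} = \<alpha> (meet_image g U)" for U
    by (simp add: g_one)
  have bound: "?F U V \<preceq> ?F U {\<one>}" for U V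
    unfolding full by (intro observable_mono [OF obs]) simp
  have empty: "?F U {} = \<zero>" for U
    using obs by (simp add: observable_def)
  have singleton: "?F {} {c} = c" if "c \<in> T" for c
    using that by (simp add: preimage)
  have exchange: "?F (U \<union> {c}) {\<one>} \<ominus> ?F (U \<union> {c}) V = ?F U (V \<union> {c}) \<ominus> ?F U V"
    if "U \<in> Fpow T" "V \<in> Fpow T" for U V c
    unfolding full using that observable_exchange [OF obs] by (simp add: Fpow_def)
  show ?thesis
    unfolding strong_compatibility_support_mapping_def compatibility_support_mapping_def
    by (intro conjI ballI impI \<open>\<one> \<in> T\<close> mono bound empty singleton exchange)
qed

lemma coexistent_admits_strong_mapping:
  assumes "coexistent TYPE('b::boolean_algebra) S"
  shows "admits_strong_compatibility_support_mapping (S \<union> {\<one>})"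
proof -
  obtain \<alpha> :: "'b \<Rightarrow> 'a" where obs: "observable \<alpha>" and range: "S \<subseteq> range \<alpha>"
    using assms unfolding coexistent_def by blast
  \<comment> \<open>The preimage of \<open>\<one>\<close> cannot be left to chance: it may differ from \<open>top\<close>.\<close>
  define g where "g = (inv \<alpha>)(\<one> := top)"
  have "\<alpha> (g c) = c" if "c \<in> S \<union> {\<one>}" for c
    using that range obs by (auto simp: g_def observable_def f_inv_into_f)
  then have "strong_compatibility_support_mapping (S \<union> {\<one>})
      (\<lambda>U V. \<alpha> (inf (meet_image g U) (join_image g V)))"
    by (intro strong_mapping_of_observable [OF obs]) (simp_all add: g_def)
  then show ?thesis
    unfolding admits_strong_compatibility_support_mapping_def by blast
qed

end

theorem theorem2:
  fixes oplus :: "'a \<Rightarrow> 'a \<Rightarrow> 'a option" and zero one :: 'a and S :: "'a set"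
  assumes "effect_algebra oplus zero one"
    and "effect_algebra.coexistent oplus zero one TYPE('b::boolean_algebra) S"
  shows "effect_algebra.admits_strong_compatibility_support_mapping oplus zero one (S \<union> {one})"
  using assms by (rule effect_algebra.coexistent_admits_strong_mapping)

end
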